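(* Let $q$ be a prime power and let $G=\mathrm{PGL}(2,q)$ in its natural $2$-transitive action on the $q+1$ points of the projective line. Then $\mathbf{d}_G=(q-1)q/2$, and for every inverse-closed $D\subseteq\mathrm{Der}(G)$ having fewer than $(q-1)q/2$ labels, $\alpha(\mathrm{Cay}(G,\mathrm{Der}(G)\setminus D))=\alpha(\Gamma_G)=|G|/(q+1)$. Thus $G$ is EKR robust.
   Context: For a finite transitive permutation group $G$ of degree $m$ acting on a set $\Omega$: a derangement is an element with no fixed point; $\mathrm{Der}(G)$ is the set of derangements. For inverse-closed $S\subseteq G$ not containing the identity, $\mathrm{Cay}(G,S)$ has vertex set $G$, with $g,h$ adjacent iff $g^{-1}h\in S$. $\Gamma_G=\mathrm{Cay}(G,\mathrm{Der}(G))$; $\alpha$ is the independence number. A label is a set $\{d,d^{-1}\}$ with $d\in \mathrm{Der}(G)$; the number of labels of $D\subseteq\mathrm{Der}(G)$ is $|\{\{d,d^{-1}\}:d\in D\}|$. For $i\neq j$, $D_{i\to j}=\{d\in\mathrm{Der}(G): d(i)=j\}$ and $\mathbf{d}_G=\min_{i\ne j}|\{\{d,d^{-1}\}:d\in D_{i\to j}\}|$. $G$ is EKR robust if $\alpha(\mathrm{Cay}(G,\mathrm{Der}(G)\setminus D))=|G|/m$ for every inverse-closed $D\subseteq\mathrm{Der}(G)$ with fewer than $\mathbf{d}_G$ labels. *)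

theory Defs
  imports "HOL-Analysis.Determinants" "HOL-Algebra.Group_Action"
begin

section \<open>Cayley graphs and the independence number\<close>

record 'v graph =
  vertices :: "'v set"
  adjacent :: "'v \<Rightarrow> 'v \<Rightarrow> bool"

definition independent_set :: "'v graph \<Rightarrow> 'v set \<Rightarrow> bool" where
  "independent_set \<Gamma> I \<longleftrightarrow> I \<subseteq> vertices \<Gamma> \<and> (\<forall>x\<in>I. \<forall>y\<in>I. \<not> adjacent \<Gamma> x y)"

text \<open>Meaningful for finite vertex sets only, since \<^const>\<open>Max\<close> is.\<close>

definition independence_number :: "'v graph \<Rightarrow> nat" where
  "independence_number \<Gamma> = Max (card ` {I. independent_set \<Gamma> I})"

text \<open>A simple graph whenever \<open>S\<close> is inverse-closed and does not contain the identity.\<close>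

definition Cay :: "('g, 'm) monoid_scheme \<Rightarrow> 'g set \<Rightarrow> 'g graph" where
  "Cay G S =
     \<lparr>vertices = carrier G,
      adjacent = (\<lambda>g h. g \<in> carrier G \<and> h \<in> carrier G \<and> inv\<^bsub>G\<^esub> g \<otimes>\<^bsub>G\<^esub> h \<in> S)\<rparr>"

definition inverse_closed :: "('g, 'm) monoid_scheme \<Rightarrow> 'g set \<Rightarrow> bool" where
  "inverse_closed G S \<longleftrightarrow> (\<forall>s\<in>S. inv\<^bsub>G\<^esub> s \<in> S)"


section \<open>Derangements and EKR robustness\<close>

text \<open>
  A permutation group on \<open>\<Omega>\<close> is given by a group \<open>G\<close> together with a faithful action
  \<open>\<phi>\<close> of \<open>G\<close> on \<open>\<Omega>\<close> (locale \<^locale>\<open>faithful_action\<close>). The definitions below are intended for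
  finite \<open>G\<close>, finite \<open>\<Omega>\<close> with at least two points, and transitive \<open>\<phi>\<close>.
\<close>

definition Der :: "('g, 'm) monoid_scheme \<Rightarrow> 'x set \<Rightarrow> ('g \<Rightarrow> 'x \<Rightarrow> 'x) \<Rightarrow> 'g set" where
  "Der G \<Omega> \<phi> = {g \<in> carrier G. \<forall>x\<in>\<Omega>. \<phi> g x \<noteq> x}"

definition derangement_graph ::
  "('g, 'm) monoid_scheme \<Rightarrow> 'x set \<Rightarrow> ('g \<Rightarrow> 'x \<Rightarrow> 'x) \<Rightarrow> 'g graph" where
  "derangement_graph G \<Omega> \<phi> = Cay G (Der G \<Omega> \<phi>)"

definition labels :: "('g, 'm) monoid_scheme \<Rightarrow> 'g set \<Rightarrow> 'g set set" where
  "labels G D = {{d, inv\<^bsub>G\<^esub> d} | d. d \<in> D}"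

definition num_labels :: "('g, 'm) monoid_scheme \<Rightarrow> 'g set \<Rightarrow> nat" where
  "num_labels G D = card (labels G D)"

definition Der_to ::
  "('g, 'm) monoid_scheme \<Rightarrow> 'x set \<Rightarrow> ('g \<Rightarrow> 'x \<Rightarrow> 'x) \<Rightarrow> 'x \<Rightarrow> 'x \<Rightarrow> 'g set" where
  "Der_to G \<Omega> \<phi> i j = {d \<in> Der G \<Omega> \<phi>. \<phi> d i = j}"

definition min_labels :: "('g, 'm) monoid_scheme \<Rightarrow> 'x set \<Rightarrow> ('g \<Rightarrow> 'x \<Rightarrow> 'x) \<Rightarrow> nat" where
  "min_labels G \<Omega> \<phi> =
     Min {num_labels G (Der_to G \<Omega> \<phi> i j) | i j. i \<in> \<Omega> \<and> j \<in> \<Omega> \<and> i \<noteq> j}"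

definition EKR_robust :: "('g, 'm) monoid_scheme \<Rightarrow> 'x set \<Rightarrow> ('g \<Rightarrow> 'x \<Rightarrow> 'x) \<Rightarrow> bool" where
  "EKR_robust G \<Omega> \<phi> \<longleftrightarrow>
     (\<forall>D. D \<subseteq> Der G \<Omega> \<phi> \<longrightarrow> inverse_closed G D \<longrightarrow> num_labels G D < min_labels G \<Omega> \<phi> \<longrightarrow>
        real (independence_number (Cay G (Der G \<Omega> \<phi> - D))) = real (order G) / real (card \<Omega>))"


section \<open>The group \<open>PGL(2,q)\<close> acting on the projective line\<close>

text \<open>The field with \<open>q\<close> elements is a type \<open>'a :: {field, finite}\<close> with \<open>CARD('a) = q\<close>.\<close>

definition GL2 :: "('a::field ^ 2 ^ 2) monoid" where
  "GL2 = \<lparr>carrier = {A. invertible A}, mult = (**), one = mat 1\<rparr>"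

definition scalars2 :: "('a::field ^ 2 ^ 2) set" where
  "scalars2 = {mat c | c. c \<noteq> 0}"

definition PGL2 :: "('a::field ^ 2 ^ 2) set monoid" where
  "PGL2 = GL2 Mod scalars2"

definition proj_line :: "('a::field ^ 2) set set" where
  "proj_line = {L. vec.subspace L \<and> vec.dim L = 1}"

text \<open>
  An element of \<^const>\<open>PGL2\<close> is a coset \<open>C\<close> of the scalar matrices. All \<open>A \<in> C\<close> map a
  line \<open>L\<close> to the same line, so the union below is just the image of \<open>L\<close> under any
  representative (lemma \<open>PGL2_act_coset\<close>).
\<close>

definition PGL2_act :: "('a::field ^ 2 ^ 2) set \<Rightarrow> ('a ^ 2) set \<Rightarrow> ('a ^ 2) set" where
  "PGL2_act C = (\<lambda>L\<in>proj_line. \<Union>A\<in>C. (\<lambda>v. A *v v) ` L)"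


subsection \<open>The action is faithful and 2-transitive, on \<open>q + 1\<close> points\<close>

lemma proj_line_eq: "proj_line = {vec.span {v} | v. v \<noteq> (0 :: 'a::field ^ 2)}"
proof (intro subset_antisym subsetI)
  fix L :: "('a ^ 2) set" assume "L \<in> proj_line"
  then have L: "vec.subspace L" "vec.dim L = 1" by (auto simp: proj_line_def)
  obtain B where B: "B \<subseteq> L" "vec.independent B" "L \<subseteq> vec.span B" "card B = vec.dim L"
    by (rule vec.basis_exists)
  then obtain v where v: "B = {v}" using L by (auto simp: card_1_singleton_iff)
  have "v \<noteq> 0" using B(2) v vec.dependent_zero by auto
  moreover have "vec.span {v} \<subseteq> L" using B(1) L(1) v by (simp add: vec.span_minimal)
  ultimately show "L \<in> {vec.span {v} | v. v \<noteq> 0}" using B(3) v by blast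
next
  fix L :: "('a ^ 2) set" assume "L \<in> {vec.span {v} | v. v \<noteq> 0}"
  then obtain v where v: "v \<noteq> 0" "L = vec.span {v}" by blast
  have "vec.independent {v}" using v(1) by simp
  then have "vec.dim L = 1"
    using v(2) vec.dim_eq_card_independent[of "{v}"] by simp
  then show "L \<in> proj_line" using v by (simp add: proj_line_def)
qed

lemma span_eq_iff2:
  fixes v w :: "'a::field ^ 2"
  assumes "v \<noteq> 0"
  shows "vec.span {v} = vec.span {w} \<longleftrightarrow> (\<exists>c. c \<noteq> 0 \<and> v = c *s w)"
proof
  assume "vec.span {v} = vec.span {w}"
  then have "v \<in> vec.span {w}" using vec.span_base by blast
  then obtain c where "v = c *s w" by (auto simp: vec.span_singleton)
  with assms show "\<exists>c. c \<noteq> 0 \<and> v = c *s w" by auto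
next
  assume "\<exists>c. c \<noteq> 0 \<and> v = c *s w"
  then obtain c where c: "c \<noteq> 0" "v = c *s w" by blast
  have "k *s v = (k * c) *s w" "k *s w = (k / c) *s v" for k
    using c by (simp_all add: vec.scale_scale)
  then show "vec.span {v} = vec.span {w}"
    unfolding vec.span_singleton by (metis (no_types, lifting) image_cong rangeI image_subset_iff subset_antisym)
qed

lemma group_GL2: "Group.group (GL2 :: ('a::field ^ 2 ^ 2) monoid)"
proof (rule groupI)
  fix A :: "'a ^ 2 ^ 2" assume "A \<in> carrier GL2"
  then show "\<exists>B\<in>carrier GL2. B \<otimes>\<^bsub>GL2\<^esub> A = \<one>\<^bsub>GL2\<^esub>"
    by (auto simp: GL2_def invertible_def)
qed (auto simp: GL2_def invertible_mult matrix_mul_assoc invertible_det_nz[of "mat 1"])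

lemma mat_scale_vec: "(mat c ** (A :: 'a ^ 2 ^ 2)) *v v = c *s (A *v (v :: 'a::field ^ 2))"
proof -
  have "mat c *v w = c *s w" for w :: "'a ^ 2"
    by (simp add: vec_eq_iff matrix_vector_mult_def mat_def forall_2 sum_2)
  then show ?thesis by (simp flip: matrix_vector_mul_assoc)
qed

lemma mat_comm: "mat c ** (A :: 'a ^ 2 ^ 2) = A ** (mat c :: 'a::field ^ 2 ^ 2)"
  by (simp add: vec_eq_iff matrix_matrix_mult_def mat_def forall_2 sum_2)

lemma mat_mat: "mat c ** mat d = (mat (c * d) :: 'a::field ^ 2 ^ 2)"
  by (simp add: vec_eq_iff matrix_matrix_mult_def mat_def forall_2 sum_2)

lemma mat_invertible: "invertible (mat c :: 'a::field ^ 2 ^ 2) \<longleftrightarrow> c \<noteq> 0"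
  by (simp add: invertible_det_nz det_2 mat_def)

lemma normal_scalars2: "scalars2 \<lhd> (GL2 :: ('a::field ^ 2 ^ 2) monoid)"
proof -
  interpret GL: Group.group "GL2 :: ('a ^ 2 ^ 2) monoid" by (rule group_GL2)
  have inv: "inv\<^bsub>GL2\<^esub> (mat c) = (mat (1 / c) :: 'a ^ 2 ^ 2)" if "c \<noteq> 0" for c
    using that by (intro GL.inv_equality) (auto simp: GL2_def mat_mat mat_invertible)
  have sub: "subgroup scalars2 (GL2 :: ('a ^ 2 ^ 2) monoid)"
  proof (rule GL.subgroupI)
    show "scalars2 \<subseteq> carrier (GL2 :: ('a ^ 2 ^ 2) monoid)"
      by (auto simp: scalars2_def GL2_def mat_invertible)
    show "(scalars2 :: ('a ^ 2 ^ 2) set) \<noteq> {}"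
      by (auto simp: scalars2_def intro!: exI[of _ 1])
    show "inv\<^bsub>GL2\<^esub> A \<in> scalars2" if A: "A \<in> scalars2" for A :: "'a ^ 2 ^ 2"
    proof -
      obtain c where c: "A = mat c" "c \<noteq> 0" using A by (auto simp: scalars2_def)
      then show ?thesis using inv[of c] by (auto simp: scalars2_def intro!: exI[of _ "1 / c"])
    qed
    show "A \<otimes>\<^bsub>GL2\<^esub> B \<in> scalars2"
      if "A \<in> scalars2" "B \<in> scalars2" for A B :: "'a ^ 2 ^ 2"
      using that by (auto simp: scalars2_def GL2_def mat_mat)
  qed
  show ?thesis
  proof (rule GL.normalI[OF sub], intro ballI)
    fix A :: "'a ^ 2 ^ 2" assume "A \<in> carrier GL2"
    show "scalars2 #>\<^bsub>GL2\<^esub> A = A <#\<^bsub>GL2\<^esub> scalars2"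
      by (auto simp: r_coset_def l_coset_def scalars2_def GL2_def mat_comm)
  qed
qed

lemma group_PGL2: "Group.group (PGL2 :: ('a::field ^ 2 ^ 2) set monoid)"
  unfolding PGL2_def by (rule normal.factorgroup_is_group[OF normal_scalars2])

definition coset2 :: "'a::field ^ 2 ^ 2 \<Rightarrow> ('a ^ 2 ^ 2) set" where
  "coset2 A = scalars2 #>\<^bsub>GL2\<^esub> A"

lemma carrier_PGL2: "carrier PGL2 = coset2 ` {A. invertible A}"
  by (auto simp: PGL2_def carrier_FactGroup coset2_def GL2_def)

lemma mult_PGL2:
  "invertible A \<Longrightarrow> invertible B \<Longrightarrow> coset2 A \<otimes>\<^bsub>PGL2\<^esub> coset2 B = coset2 (A ** B)"
  using normal.rcos_sum[OF normal_scalars2, of A B]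
  by (simp add: PGL2_def coset2_def GL2_def)

lemma coset2_eq: "coset2 A = {mat c ** A | c. c \<noteq> 0}"
  by (auto simp: coset2_def r_coset_def scalars2_def GL2_def)

lemma PGL2_act_coset:
  assumes "L \<in> proj_line"
  shows "PGL2_act (coset2 A) L = (\<lambda>v. A *v v) ` L"
proof -
  have sub: "vec.subspace L" using assms by (simp add: proj_line_def)
  have "(\<Union>B\<in>coset2 A. (\<lambda>v. B *v v) ` L) = (\<lambda>v. A *v v) ` L"
  proof (intro equalityI subsetI)
    fix w assume "w \<in> (\<Union>B\<in>coset2 A. (\<lambda>v. B *v v) ` L)"
    then obtain c v where "v \<in> L" "w = (mat c ** A) *v v" by (auto simp: coset2_eq)
    then have "c *s v \<in> L" "w = A *v (c *s v)"
      using sub by (auto simp: mat_scale_vec vec.subspace_scale vector_scalar_commute)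
    then show "w \<in> (\<lambda>v. A *v v) ` L" by blast
  next
    fix w assume "w \<in> (\<lambda>v. A *v v) ` L"
    moreover have "A \<in> coset2 A" by (auto simp: coset2_eq intro!: exI[of _ 1])
    ultimately show "w \<in> (\<Union>B\<in>coset2 A. (\<lambda>v. B *v v) ` L)" by blast
  qed
  then show ?thesis using assms by (simp add: PGL2_act_def)
qed

lemma inj_mult_vec:
  fixes v :: "'a::field ^ 2"
  assumes "invertible A" "v \<noteq> 0" shows "A *v v \<noteq> 0"
proof -
  obtain B where "B ** A = mat 1" using assms(1) by (auto simp: invertible_def)
  then have "B *v (A *v v) = v" by (simp add: matrix_vector_mul_assoc)
  then show ?thesis using assms(2) by auto
qed

lemma PGL2_act_span:
  assumes "v \<noteq> 0"
  shows "PGL2_act (coset2 A) (vec.span {v}) = vec.span {A *v v}"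
proof -
  have "vec.span {v} \<in> proj_line" using assms by (auto simp: proj_line_eq)
  then show ?thesis
    by (simp add: PGL2_act_coset vec.span_singleton image_image vector_scalar_commute)
qed

lemma PGL2_act_closed:
  assumes "invertible A" "L \<in> proj_line"
  shows "PGL2_act (coset2 A) L \<in> proj_line"
proof -
  obtain v where "v \<noteq> 0" "L = vec.span {v}" using assms(2) by (auto simp: proj_line_eq)
  then show ?thesis
    using inj_mult_vec[OF assms(1)] by (auto simp: PGL2_act_span proj_line_eq)
qed

lemma PGL2_act_mult:
  assumes "invertible B" "L \<in> proj_line"
  shows "PGL2_act (coset2 (A ** B)) L = PGL2_act (coset2 A) (PGL2_act (coset2 B) L)"
proof -
  obtain v where "v \<noteq> 0" "L = vec.span {v}" using assms(2) by (auto simp: proj_line_eq)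
  then show ?thesis
    using inj_mult_vec[OF assms(1)] by (simp add: PGL2_act_span matrix_vector_mul_assoc)
qed

lemma PGL2_act_one: "L \<in> proj_line \<Longrightarrow> PGL2_act (coset2 (mat 1)) L = L"
  by (simp add: PGL2_act_coset)

lemma PGL2_act_Bij:
  assumes "invertible A" shows "PGL2_act (coset2 A) \<in> Bij proj_line"
proof -
  obtain B where B: "A ** B = mat 1" "B ** A = mat 1" using assms by (auto simp: invertible_def)
  then have iB: "invertible B" by (auto simp: invertible_def)
  have "bij_betw (PGL2_act (coset2 A)) proj_line proj_line"
    by (rule bij_betw_byWitness[where f' = "PGL2_act (coset2 B)"])
      (use B iB assms in \<open>auto simp: PGL2_act_closed PGL2_act_one simp flip: PGL2_act_mult\<close>)
  moreover have "PGL2_act (coset2 A) \<in> extensional proj_line" by (simp add: PGL2_act_def)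
  ultimately show ?thesis by (simp add: Bij_def)
qed

lemma group_action_PGL2: "group_action (PGL2 :: ('a::field ^ 2 ^ 2) set monoid) proj_line PGL2_act"
proof -
  have "PGL2_act \<in> hom (PGL2 :: ('a ^ 2 ^ 2) set monoid) (BijGroup proj_line)"
  proof (rule homI)
    fix X assume "X \<in> carrier (PGL2 :: ('a ^ 2 ^ 2) set monoid)"
    then show "PGL2_act X \<in> carrier (BijGroup proj_line)"
      by (auto simp: carrier_PGL2 BijGroup_def PGL2_act_Bij)
  next
    fix X Y assume "X \<in> carrier (PGL2 :: ('a ^ 2 ^ 2) set monoid)" "Y \<in> carrier (PGL2 :: ('a ^ 2 ^ 2) set monoid)"
    then obtain A B where AB: "invertible A" "invertible B" "X = coset2 A" "Y = coset2 B"
      by (auto simp: carrier_PGL2)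
    have "PGL2_act (coset2 (A ** B)) = compose proj_line (PGL2_act (coset2 A)) (PGL2_act (coset2 B))"
    proof
      fix L show "PGL2_act (coset2 (A ** B)) L = compose proj_line (PGL2_act (coset2 A)) (PGL2_act (coset2 B)) L"
        using AB by (cases "L \<in> proj_line") (simp_all add: PGL2_act_mult compose_def, simp add: PGL2_act_def)
    qed
    then show "PGL2_act (X \<otimes>\<^bsub>PGL2\<^esub> Y) = PGL2_act X \<otimes>\<^bsub>BijGroup proj_line\<^esub> PGL2_act Y"
      using AB by (simp add: mult_PGL2 BijGroup_def PGL2_act_Bij)
  qed
  then show ?thesis
    by (simp add: group_action_def group_hom_def group_hom_axioms_def group_PGL2 group_BijGroup)
qed

lemma faithful_action_PGL2: "faithful_action (PGL2 :: ('a::field ^ 2 ^ 2) set monoid) proj_line PGL2_act"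
proof -
  have "inj_on PGL2_act (carrier (PGL2 :: ('a ^ 2 ^ 2) set monoid))"
  proof (rule inj_onI)
    fix X Y :: "('a ^ 2 ^ 2) set"
    assume "X \<in> carrier PGL2" "Y \<in> carrier PGL2" and eq: "PGL2_act X = PGL2_act Y"
    then obtain A B where AB: "invertible A" "invertible B" "X = coset2 A" "Y = coset2 B"
      by (auto simp: carrier_PGL2)
    obtain B' where B': "B ** B' = mat 1" "B' ** B = mat 1" using AB by (auto simp: invertible_def)
    define M where "M = B' ** A"
    have BM: "B ** M = A" using B' by (simp add: M_def matrix_mul_assoc)
    have iM: "invertible M"
      unfolding M_def using AB B' by (intro invertible_mult) (auto simp: invertible_def)
    have fix_v: "\<exists>c. c \<noteq> 0 \<and> M *v v = c *s v" if v: "v \<noteq> 0" for v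
    proof -
      have "vec.span {A *v v} = vec.span {B *v v}"
        using eq AB PGL2_act_span[OF v] by metis
      then obtain c where c: "c \<noteq> 0" "A *v v = c *s (B *v v)"
        using span_eq_iff2 inj_mult_vec[OF AB(1) v] by blast
      have "M *v v = B' *v (A *v v)" by (simp add: M_def matrix_vector_mul_assoc)
      also have "\<dots> = c *s ((B' ** B) *v v)"
        by (simp add: c(2) vector_scalar_commute matrix_vector_mul_assoc)
      finally show ?thesis using c(1) B' by auto
    qed
    obtain a where a: "a \<noteq> 0" "M *v vector [1, 0] = a *s vector [1, 0]"
      using fix_v[of "vector [1, 0]"] by (auto simp: vec_eq_iff forall_2)
    obtain b where b: "M *v vector [0, 1] = b *s vector [0, 1]"
      using fix_v[of "vector [0, 1]"] by (auto simp: vec_eq_iff forall_2)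
    obtain c where c: "M *v vector [1, 1] = c *s vector [1, 1]"
      using fix_v[of "vector [1, 1]"] by (auto simp: vec_eq_iff forall_2)
    have "M = mat a"
      using a b c by (auto simp: vec_eq_iff forall_2 matrix_vector_mult_def sum_2 mat_def)
    then have "A = mat a ** B" using BM by (simp add: mat_comm)
    then have "X = {mat (c * a) ** B | c. c \<noteq> 0}"
      by (simp add: AB coset2_eq matrix_mul_assoc mat_mat)
    also have "\<dots> = Y"
      using a(1) by (auto simp: AB coset2_eq) (metis divide_eq_0_iff nonzero_eq_divide_eq)
    finally show "X = Y" .
  qed
  then show ?thesis
    by (simp add: faithful_action_def faithful_action_axioms_def group_action_PGL2)
qed

lemma two_transitive_PGL2:
  fixes i j i' j' :: "('a::field ^ 2) set"
  assumes "i \<in> proj_line" "j \<in> proj_line" "i \<noteq> j"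
    and "i' \<in> proj_line" "j' \<in> proj_line" "i' \<noteq> j'"
  shows "\<exists>g\<in>carrier PGL2. PGL2_act g i = i' \<and> PGL2_act g j = j'"
proof -
  let ?e = "vector [1, 0] :: 'a ^ 2" and ?f = "vector [0, 1] :: 'a ^ 2"
  have nz: "?e \<noteq> 0" "?f \<noteq> 0" by (auto simp: vec_eq_iff forall_2)
  have std: "\<exists>P. invertible P \<and> PGL2_act (coset2 P) (vec.span {?e}) = k \<and>
      PGL2_act (coset2 P) (vec.span {?f}) = l"
    if kl: "k \<in> proj_line" "l \<in> proj_line" "k \<noteq> l" for k l
  proof -
    obtain v w where vw: "v \<noteq> 0" "w \<noteq> 0" "k = vec.span {v}" "l = vec.span {w}"
      using kl by (auto simp: proj_line_eq)
    define P :: "'a ^ 2 ^ 2" where "P = vector [vector [v $ 1, w $ 1], vector [v $ 2, w $ 2]]"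
    have P: "P *v ?e = v" "P *v ?f = w"
      by (simp_all add: P_def vec_eq_iff forall_2 matrix_vector_mult_def sum_2)
    have "det P \<noteq> 0"
    proof
      assume "det P = 0"
      then have d: "v $ 1 * w $ 2 = w $ 1 * v $ 2" by (simp add: P_def det_2)
      have "\<exists>c. v = c *s w"
      proof (cases "w $ 1 = 0")
        case True
        then have "w $ 2 \<noteq> 0" using vw(2) by (auto simp: vec_eq_iff forall_2)
        then show ?thesis using d True
          by (intro exI[of _ "v $ 2 / w $ 2"]) (simp add: vec_eq_iff forall_2)
      next
        case False
        then show ?thesis using d
          by (intro exI[of _ "v $ 1 / w $ 1"]) (simp add: vec_eq_iff forall_2 field_simps)
      qed
      then have "k = l" using vw span_eq_iff2[of v w] by auto
      with kl show False by simp
    qed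
    then show ?thesis using P vw nz by (auto simp: invertible_det_nz PGL2_act_span)
  qed
  obtain P where P: "invertible P" "PGL2_act (coset2 P) (vec.span {?e}) = i"
      "PGL2_act (coset2 P) (vec.span {?f}) = j"
    using std[OF assms(1-3)] by blast
  obtain Q where Q: "invertible Q" "PGL2_act (coset2 Q) (vec.span {?e}) = i'"
      "PGL2_act (coset2 Q) (vec.span {?f}) = j'"
    using std[OF assms(4-6)] by blast
  obtain P' where P': "P' ** P = mat 1" "P ** P' = mat 1" using P by (auto simp: invertible_def)
  have iP': "invertible P'" using P' by (auto simp: invertible_def)
  have "vec.span {?e} \<in> proj_line" "vec.span {?f} \<in> proj_line" using nz by (auto simp: proj_line_eq)
  then have "PGL2_act (coset2 P') i = vec.span {?e}" "PGL2_act (coset2 P') j = vec.span {?f}"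
    using P P' by (auto simp: PGL2_act_one simp flip: PGL2_act_mult)
  then have "PGL2_act (coset2 (Q ** P')) i = i'" "PGL2_act (coset2 (Q ** P')) j = j'"
    using Q iP' assms by (auto simp: PGL2_act_mult)
  moreover have "coset2 (Q ** P') \<in> carrier PGL2"
    using Q iP' by (auto simp: carrier_PGL2 invertible_mult)
  ultimately show ?thesis by blast
qed

lemma card_proj_line: "card (proj_line :: ('a::{field,finite} ^ 2) set set) = CARD('a) + 1"
proof -
  define f :: "'a option \<Rightarrow> ('a ^ 2) set"
    where "f x = vec.span {case x of None \<Rightarrow> vector [0, 1] | Some c \<Rightarrow> vector [1, c]}" for x
  have nz: "vector [1, c] \<noteq> (0 :: 'a ^ 2)" "vector [0, 1] \<noteq> (0 :: 'a ^ 2)" for c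
    by (auto simp: vec_eq_iff forall_2)
  have "inj f"
  proof (rule injI)
    fix x y assume "f x = f y"
    then show "x = y"
      by (auto simp: f_def span_eq_iff2 nz vec_eq_iff forall_2 split: option.splits)
  qed
  moreover have "range f = proj_line"
  proof (intro equalityI subsetI)
    fix L assume "L \<in> range f"
    then show "L \<in> proj_line" using nz by (auto simp: f_def proj_line_eq split: option.splits)
  next
    fix L :: "('a ^ 2) set" assume "L \<in> proj_line"
    then obtain v where v: "v \<noteq> 0" "L = vec.span {v}" by (auto simp: proj_line_eq)
    show "L \<in> range f"
    proof (cases "v $ 1 = 0")
      case True
      then have "v $ 2 \<noteq> 0" using v(1) by (auto simp: vec_eq_iff forall_2)
      then have "L = f None" using v True
        by (auto simp: f_def span_eq_iff2 vec_eq_iff forall_2)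
      then show ?thesis by simp
    next
      case False
      then have "L = f (Some (v $ 2 / v $ 1))" using v
        by (auto simp: f_def span_eq_iff2 vec_eq_iff forall_2 intro!: exI[of _ "v $ 1"])
      then show ?thesis by simp
    qed
  qed
  ultimately have "card (proj_line :: ('a ^ 2) set set) = CARD('a option)"
    by (metis card_image)
  then show ?thesis by simp
qed

end

theory Submission
  imports Defs
begin

text \<open>
  The derangements of \<open>PGL(2,q)\<close> are the non-identity elements of its non-split tori: cyclic
  subgroups of order \<open>q + 1\<close>, each regular on the projective line, any two meeting trivially.
  By regularity every torus has exactly one element mapping \<open>i\<close> to \<open>j\<close>, and its label lies inside
  that torus, so \<open>\<^bold>d\<^sub>G\<close> is the number of tori. There is one torus for each monic quadratic without
  roots, which makes \<open>q(q-1)/2\<close> of them. A set \<open>D\<close> with fewer labels misses some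
  torus, which is then a clique of size \<open>q + 1\<close> in \<open>Cay(G, Der(G) - D)\<close>; its left translates are
  cliques as well, so an independent set has at most \<open>|G|/(q+1)\<close> elements. A point stabilizer
  attains this bound.
\<close>

section \<open>Groups whose derangements are partitioned by regular subgroups\<close>

text \<open>\<open>transitive_part\<close> and \<open>Der_part\<close> together make each part
  regular on E; \<open>disjoint_parts\<close> and \<open>Der_covered\<close> make the non-identity
  elements of the parts a partition of the derangements.\<close>

locale regular_derangement_partition = group_action +
  fixes \<T> :: "'a set set"
  assumes finite_carrier: "finite (carrier G)"
    and finite_points: "finite E"
    and two_points: "\<exists>i\<in>E. \<exists>j\<in>E. i \<noteq> j"
    and subgroup_part: "C \<in> \<T> \<Longrightarrow> subgroup C G"
    and transitive_part: "C \<in> \<T> \<Longrightarrow> i \<in> E \<Longrightarrow> j \<in> E \<Longrightarrow> \<exists>c\<in>C. \<phi> c i = j"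
    and Der_part: "C \<in> \<T> \<Longrightarrow> c \<in> C \<Longrightarrow> c \<noteq> \<one> \<Longrightarrow> c \<in> Der G E \<phi>"
    and disjoint_parts: "C \<in> \<T> \<Longrightarrow> C' \<in> \<T> \<Longrightarrow> c \<in> C \<Longrightarrow> c \<in> C' \<Longrightarrow> c \<noteq> \<one> \<Longrightarrow> C = C'"
    and Der_covered: "d \<in> Der G E \<phi> \<Longrightarrow> \<exists>C\<in>\<T>. d \<in> C"
begin

section \<open>Regularity of the parts\<close>

sublocale group G
  using group_hom group_hom_def by blast

lemma act_one: "x \<in> E \<Longrightarrow> \<phi> \<one> x = x"
  by (metis id_eq_one restrict_apply')

lemma one_notin_Der: "\<one> \<notin> Der G E \<phi>"
  using two_points act_one by (auto simp: Der_def)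

text \<open>The quotient \<open>inv d \<otimes> c\<close> lies in the part and fixes x, so it is not
  a derangement and must be the identity.\<close>

lemma part_element_unique:
  assumes C: "C \<in> \<T>" and "c \<in> C" "d \<in> C" "x \<in> E" "\<phi> c x = \<phi> d x"
  shows "c = d"
proof -
  interpret C: subgroup C G using C by (rule subgroup_part)
  have G: "c \<in> carrier G" "d \<in> carrier G" using assms by auto
  have "\<phi> (inv d \<otimes> c) x = x"
    using assms G by (metis composition_rule inv_closed orbit_sym_aux)
  moreover have "inv d \<otimes> c \<in> C" using assms by simp
  ultimately have "inv d \<otimes> c = \<one>"
    using Der_part[OF C] \<open>x \<in> E\<close> by (auto simp: Der_def)
  then show ?thesis using G by (metis inv_closed inv_equality inv_inv)
qed

lemma card_part:
  assumes C: "C \<in> \<T>" shows "card C = card E"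
proof -
  obtain x where x: "x \<in> E" using two_points by blast
  interpret C: subgroup C G using C by (rule subgroup_part)
  have "bij_betw (\<lambda>c. \<phi> c x) C E"
    unfolding bij_betw_def
  proof
    show "inj_on (\<lambda>c. \<phi> c x) C" using part_element_unique[OF C _ _ x] by (auto intro: inj_onI)
    show "(\<lambda>c. \<phi> c x) ` C = E"
      using transitive_part[OF C x] element_image[OF _ x] C.subset by blast
  qed
  then show ?thesis by (rule bij_betw_same_card)
qed

text \<open>The label of a derangement lies in the part containing it, and so determines that part.\<close>

lemma inj_on_label:
  assumes "\<And>C. C \<in> \<T> \<Longrightarrow> f C \<in> C \<inter> Der G E \<phi>"
  shows "inj_on (\<lambda>C. {f C, inv (f C)}) \<T>"
proof (rule inj_onI)
  fix C C' assume C: "C \<in> \<T>" "C' \<in> \<T>" and "{f C, inv (f C)} = {f C', inv (f C')}"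
  then have "f C \<in> C'"
    using assms subgroup.m_inv_closed[OF subgroup_part[OF C(2)]]
    by (metis IntD1 doubleton_eq_iff)
  then show "C = C'"
    using C assms disjoint_parts one_notin_Der by (metis IntD1 IntD2)
qed

section \<open>Counting labels by parts\<close>

lemma finite_labels:
  assumes "D \<subseteq> Der G E \<phi>" shows "finite (labels G D)"
proof -
  have "finite D" using assms finite_carrier by (auto simp: Der_def intro: finite_subset)
  then show ?thesis by (simp add: labels_def)
qed

text \<open>Each part contributes one label, that of its unique element sending i to j; this element
  is a derangement because it moves i. Labels from different parts differ by
  \<open>inj_on_label\<close>.\<close>

lemma num_labels_Der_to:
  assumes ij: "i \<in> E" "j \<in> E" "i \<noteq> j"
  shows "num_labels G (Der_to G E \<phi> i j) = card \<T>"
proof -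
  obtain f where f: "\<And>C. C \<in> \<T> \<Longrightarrow> f C \<in> C \<and> \<phi> (f C) i = j"
    using transitive_part[OF _ ij(1,2)] by metis
  have f_Der: "f C \<in> Der G E \<phi>" if "C \<in> \<T>" for C
    using f[OF that] ij act_one Der_part[OF that] by metis
  have "(\<lambda>C. {f C, inv (f C)}) ` \<T> = labels G (Der_to G E \<phi> i j)"
  proof (intro equalityI subsetI)
    fix l assume "l \<in> labels G (Der_to G E \<phi> i j)"
    then obtain d where d: "l = {d, inv d}" "d \<in> Der G E \<phi>" "\<phi> d i = j"
      by (auto simp: labels_def Der_to_def)
    then obtain C where C: "C \<in> \<T>" "d \<in> C" using Der_covered by blast
    then have "f C = d" using part_element_unique[OF C(1) _ _ ij(1)] f d by metis
    then show "l \<in> (\<lambda>C. {f C, inv (f C)}) ` \<T>" using C d by blast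
  qed (use f f_Der in \<open>auto simp: labels_def Der_to_def\<close>)
  moreover have "inj_on (\<lambda>C. {f C, inv (f C)}) \<T>"
    using f f_Der by (intro inj_on_label) blast
  ultimately show ?thesis by (metis card_image num_labels_def)
qed

lemma min_labels_eq: "min_labels G E \<phi> = card \<T>"
proof -
  have "{num_labels G (Der_to G E \<phi> i j) | i j. i \<in> E \<and> j \<in> E \<and> i \<noteq> j} = {card \<T>}"
    using two_points num_labels_Der_to by (auto, metis)
  then show ?thesis by (simp add: min_labels_def)
qed

text \<open>Pigeonhole: if D met every part, one element chosen from each intersection would give
  \<open>card \<T>\<close> different labels in D.\<close>

lemma part_avoiding_few_labels:
  assumes D: "D \<subseteq> Der G E \<phi>" and few: "num_labels G D < card \<T>"
  obtains C where "C \<in> \<T>" "C \<inter> D = {}"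
proof (rule ccontr)
  assume "\<not> thesis"
  then have "\<forall>C\<in>\<T>. \<exists>d. d \<in> C \<inter> D" using that by blast
  then obtain f where f: "\<And>C. C \<in> \<T> \<Longrightarrow> f C \<in> C \<inter> D" by metis
  have "inj_on (\<lambda>C. {f C, inv (f C)}) \<T>"
    using f D by (intro inj_on_label) blast
  moreover have "(\<lambda>C. {f C, inv (f C)}) ` \<T> \<subseteq> labels G D"
    using f by (auto simp: labels_def)
  ultimately have "card \<T> \<le> num_labels G D"
    using finite_labels[OF D] by (simp add: card_inj_on_le num_labels_def)
  with few show False by simp
qed

lemma independence_number_few_labels:
  assumes D: "D \<subseteq> Der G E \<phi>" and few: "num_labels G D < card \<T>"
  shows "independence_number (Cay G (Der G E \<phi> - D)) * card E = order G"
proof -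
  obtain C where C: "C \<in> \<T>" "C \<inter> D = {}" using part_avoiding_few_labels[OF assms] .
  interpret C: subgroup C G using C(1) by (rule subgroup_part)
  obtain x where x: "x \<in> E" using two_points by blast
  have card_pos: "card E > 0" using x finite_points card_gt_0_iff by blast
  let ?\<Gamma> = "Cay G (Der G E \<phi> - D)"
  let ?S = "stabilizer G \<phi> x"
  \<comment> \<open>C alone moves x to every point, so orbit-stabilizer gives the stabilizer of x
    exactly the extremal size.\<close>
  have "orbit G \<phi> x = E"
    using transitive_part[OF C(1) x] C.subset element_image[OF _ x] by (force simp: orbit_def)
  then have card_S: "card ?S * card E = order G"
    using orbit_stabilizer_theorem[OF x] by (simp add: mult.commute)
  have indep_S: "independent_set ?\<Gamma> ?S"
    unfolding independent_set_def
  proof (intro conjI ballI)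
    fix g h assume "g \<in> ?S" "h \<in> ?S"
    then have "inv g \<otimes> h \<in> ?S" using x by (simp add: stabilizer_m_closed stabilizer_m_inv_closed)
    then show "\<not> adjacent ?\<Gamma> g h" using x by (auto simp: Cay_def Der_def stabilizer_def)
  qed (use stabilizer_subset in \<open>simp add: Cay_def\<close>)
  have bound: "card I * card E \<le> order G" if I: "independent_set ?\<Gamma> I" for I
  proof -
    have IG: "I \<subseteq> carrier G" using I by (simp add: independent_set_def Cay_def)
    \<comment> \<open>The translates of C by elements of I are disjoint: a collision puts
      \<open>inv g \<otimes> h\<close> into C, where every non-identity element is a derangement
      outside D and would be an edge inside I.\<close>
    have "inj_on (\<lambda>(g, c). g \<otimes> c) (I \<times> C)"
    proof (rule inj_onI, clarify)
      fix g c h d assume gh: "g \<in> I" "h \<in> I" and cd: "c \<in> C" "d \<in> C" and eq: "g \<otimes> c = h \<otimes> d"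
      have G: "g \<in> carrier G" "h \<in> carrier G" "c \<in> carrier G" "d \<in> carrier G"
        using gh cd IG by auto
      have "inv g \<otimes> h = c \<otimes> inv d"
        using eq G by (metis inv_closed inv_solve_left inv_solve_right m_assoc m_closed)
      then have "inv g \<otimes> h \<in> C" using cd by simp
      moreover have "inv g \<otimes> h \<notin> Der G E \<phi> - D"
        using I gh G by (auto simp: independent_set_def Cay_def)
      ultimately have "inv g \<otimes> h = \<one>" using Der_part[OF C(1)] C(2) by blast
      then have "g = h" using G by (metis inv_closed inv_equality inv_inv)
      then show "g = h \<and> c = d" using eq G by simp
    qed
    moreover have "(\<lambda>(g, c). g \<otimes> c) ` (I \<times> C) \<subseteq> carrier G" using IG by auto
    ultimately have "card (I \<times> C) \<le> order G"
      using finite_carrier by (simp add: card_inj_on_le order_def)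
    then show ?thesis using card_part[OF C(1)] by (simp add: card_cartesian_product)
  qed
  have "finite {I. independent_set ?\<Gamma> I}"
    by (rule finite_subset[of _ "Pow (carrier G)"])
      (use finite_carrier in \<open>auto simp: independent_set_def Cay_def\<close>)
  then have "independence_number ?\<Gamma> = card ?S"
    unfolding independence_number_def
  proof (intro Max_eqI)
    fix n assume "n \<in> card ` {I. independent_set ?\<Gamma> I}"
    then have "n * card E \<le> card ?S * card E" using bound card_S by auto
    then show "n \<le> card ?S" using card_pos by simp
  qed (use indep_S in auto)
  then show ?thesis using card_S by simp
qed

end


section \<open>Quadratics without roots\<close>

text \<open>The pair (b, d) encodes the polynomial X^2 - d X - b, with the signs that
  \<open>quad_mat\<close> uses.\<close>

definition rootless_quadratics :: "('a::field \<times> 'a) set" where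
  "rootless_quadratics = {(b, d). \<forall>z. z * z \<noteq> d * z + b}"

text \<open>These are the possible root sets of a monic quadratic with a root: r = s is a double
  root, giving the singletons.\<close>

lemma card_nonempty_subsets_le_2:
  "card {{r, s} | r s :: 'a::finite. True} = CARD('a) + (CARD('a) choose 2)"
proof -
  have "{{r, s} | r s :: 'a. True} = {S. S \<subseteq> UNIV \<and> card S = 1} \<union> {S. S \<subseteq> UNIV \<and> card S = 2}"
    by (auto simp: card_1_singleton_iff card_2_iff card_insert_if)
  moreover have "card ({S :: 'a set. S \<subseteq> UNIV \<and> card S = 1} \<union> {S. S \<subseteq> UNIV \<and> card S = 2}) =
    CARD('a) + (CARD('a) choose 2)"
    by (subst card_Un_disjoint) (auto simp: n_subsets[OF finite, of UNIV, simplified])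
  ultimately show ?thesis by simp
qed

text \<open>The complement is counted: a quadratic with a root is determined by its root set, and
  every set {r, s} occurs. This leaves q^2 - q - (q choose 2) rootless pairs.\<close>

lemma card_rootless_quadratics:
  "card (rootless_quadratics :: ('a::{field,finite} \<times> 'a) set) = CARD('a) choose 2"
proof -
  let ?Z = "\<lambda>(b, d). {z :: 'a. z * z = d * z + b}"
  \<comment> \<open>Vieta: the roots sum to d and have product -b, so one root r fixes the
    other.\<close>
  have Z: "?Z (b, d) = {r, d - r}" "b = - (r * (d - r))" if "r * r = d * r + b" for b d r :: 'a
  proof -
    show b: "b = - (r * (d - r))" using that by (simp add: algebra_simps)
    have "z * z = d * z + b \<longleftrightarrow> z = r \<or> z = d - r" for z
    proof -
      have "z * z = d * z + b \<longleftrightarrow> (z - r) * (z - (d - r)) = 0"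
        unfolding b by (simp add: algebra_simps)
      then show ?thesis by simp
    qed
    then show "?Z (b, d) = {r, d - r}" by auto
  qed
  have "bij_betw ?Z (- rootless_quadratics) {{r, s} | r s :: 'a. True}"
    unfolding bij_betw_def
  proof
    show "inj_on ?Z (- rootless_quadratics)"
    proof (rule inj_onI, clarify)
      fix b d b' d' :: 'a
      assume "(b, d) \<notin> rootless_quadratics" "(b', d') \<notin> rootless_quadratics"
        and eq: "{z. z * z = d * z + b} = {z. z * z = d' * z + b'}"
      then obtain r r' where r: "r * r = d * r + b" "r' * r' = d' * r' + b'"
        by (auto simp: rootless_quadratics_def)
      have "{r, d - r} = {r', d' - r'}" using Z(1)[OF r(1)] Z(1)[OF r(2)] eq by simp
      then show "b = b' \<and> d = d'"
        using Z(2)[OF r(1)] Z(2)[OF r(2)] by (auto simp: doubleton_eq_iff)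
    qed
    show "?Z ` (- rootless_quadratics) = {{r, s} | r s :: 'a. True}"
    proof (intro equalityI subsetI)
      fix S assume "S \<in> ?Z ` (- rootless_quadratics)"
      then obtain b d r where "S = ?Z (b, d)" "r * r = d * r + b"
        by (auto simp: rootless_quadratics_def)
      then show "S \<in> {{r, s} | r s :: 'a. True}" using Z(1) by blast
    next
      fix S assume "S \<in> {{r, s} | r s :: 'a. True}"
      then obtain r s where S: "S = {r, s}" by blast
      have r: "r * r = (r + s) * r + - (r * s)" by (simp add: algebra_simps)
      then have "(- (r * s), r + s) \<in> - rootless_quadratics"
        by (auto simp: rootless_quadratics_def)
      moreover have "S = ?Z (- (r * s), r + s)" using Z(1)[OF r] S by simp
      ultimately show "S \<in> ?Z ` (- rootless_quadratics)" by blast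
    qed
  qed
  from bij_betw_same_card[OF this]
  have "card (- rootless_quadratics :: ('a \<times> 'a) set) = CARD('a) + (CARD('a) choose 2)"
    by (simp only: card_nonempty_subsets_le_2)
  moreover have "card (- rootless_quadratics :: ('a \<times> 'a) set) =
      CARD('a) * CARD('a) - card (rootless_quadratics :: ('a \<times> 'a) set)"
    by (simp add: Compl_eq_Diff_UNIV card_Diff_subset)
  moreover have "card (rootless_quadratics :: ('a \<times> 'a) set) \<le> CARD('a) * CARD('a)"
    using card_mono[OF finite subset_UNIV, of "rootless_quadratics :: ('a \<times> 'a) set"] by simp
  moreover have "CARD('a) * CARD('a) = CARD('a) + (CARD('a) choose 2) + (CARD('a) choose 2)"
  proof -
    have "2 * (n choose 2) = n * (n - 1)" for n :: nat
      unfolding choose_two by (rule dvd_mult_div_cancel) auto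
    from this[of "CARD('a)"] show ?thesis by (cases "CARD('a)") auto
  qed
  ultimately show ?thesis by linarith
qed


section \<open>The non-split tori\<close>

text \<open>
  This is the matrix of multiplication by \<open>x + y\<theta>\<close> in the basis \<open>1, \<theta>\<close> of the quadratic
  extension generated by a root \<open>\<theta>\<close> of \<open>X\<^sup>2 - d X - b\<close>.
\<close>

definition quad_mat :: "'a::field \<Rightarrow> 'a \<Rightarrow> 'a \<Rightarrow> 'a \<Rightarrow> 'a ^ 2 ^ 2" where
  "quad_mat b d x y = vector [vector [x, y * b], vector [y, x + y * d]]"

text \<open>When (b, d) is rootless, this is the multiplicative group of the quadratic extension
  modulo that of the base field.\<close>

definition torus :: "'a::field \<times> 'a \<Rightarrow> ('a ^ 2 ^ 2) set set" where
  "torus = (\<lambda>(b, d). {coset2 (quad_mat b d x y) | x y. (x, y) \<noteq> (0, 0)})"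

lemma quad_mat_nth [simp]:
  "quad_mat b d x y $ 1 $ 1 = x" "quad_mat b d x y $ 1 $ 2 = y * b"
  "quad_mat b d x y $ 2 $ 1 = y" "quad_mat b d x y $ 2 $ 2 = x + y * d"
  by (simp_all add: quad_mat_def)

text \<open>This is the product of x + y\<theta> and x' + y'\<theta>, reduced by \<theta>^2 =
  d\<theta> + b.\<close>

lemma quad_mat_mult:
  "quad_mat b d x y ** quad_mat b d x' y' =
   quad_mat b d (x * x' + y * y' * b) (x * y' + y * x' + y * y' * d)"
  by (simp add: vec_eq_iff forall_2 matrix_matrix_mult_def sum_2 algebra_simps)

lemma quad_mat_scalar: "quad_mat b d x 0 = mat x"
  by (simp add: vec_eq_iff forall_2 mat_def)

text \<open>The determinant is the norm of x + y\<theta>. For nonzero y it is y^2 times the value of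
  the quadratic at -x/y, which is not a root.\<close>

lemma invertible_quad_mat:
  assumes "(b, d) \<in> rootless_quadratics" "(x, y) \<noteq> (0, 0)"
  shows "invertible (quad_mat b d x y)"
proof -
  have "x * (x + y * d) - y * b * y \<noteq> 0"
  proof (cases "y = 0")
    case False
    let ?z = "- (x / y)"
    have "x * (x + y * d) - y * b * y = y * y * (?z * ?z - (d * ?z + b))"
      using False by (simp add: field_simps)
    moreover have "?z * ?z \<noteq> d * ?z + b"
      using assms(1) unfolding rootless_quadratics_def by blast
    ultimately show ?thesis using False by (simp only: mult_eq_0_iff right_minus_eq simp_thms)
  qed (use assms in auto)
  then show ?thesis by (simp add: invertible_det_nz det_2)
qed

section \<open>Representatives of elements of PGL(2,q)\<close>

lemma coset2_scale: "c \<noteq> 0 \<Longrightarrow> coset2 (mat c ** A) = coset2 A"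
  by (auto simp: coset2_eq matrix_mul_assoc mat_mat) (metis divide_eq_0_iff nonzero_eq_divide_eq)

lemma coset2_eqD:
  assumes "coset2 A = coset2 B" obtains c where "c \<noteq> 0" "A = mat c ** B"
proof -
  have "A \<in> coset2 A" by (auto simp: coset2_eq intro!: exI[of _ 1])
  then have "A \<in> coset2 B" using assms by simp
  then show thesis using that by (auto simp: coset2_eq)
qed

lemma mat_mult_nth: "(mat c ** A) $ i $ j = c * (A :: 'a::field ^ 2 ^ 2) $ i $ j"
  using exhaust_2[of i] by (auto simp: matrix_matrix_mult_def mat_def sum_2)

lemma one_PGL2: "\<one>\<^bsub>PGL2\<^esub> = coset2 (mat 1)"
proof -
  have "scalars2 = (coset2 (mat 1) :: ('a ^ 2 ^ 2) set)"
    by (auto simp: coset2_eq scalars2_def)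
  then show ?thesis by (simp add: PGL2_def FactGroup_def)
qed

section \<open>The tori as regular subgroups\<close>

lemma torus_subset_carrier: "p \<in> rootless_quadratics \<Longrightarrow> torus p \<subseteq> carrier PGL2"
  by (cases p) (auto simp: torus_def carrier_PGL2 intro!: invertible_quad_mat)

lemma subgroup_torus:
  assumes p: "p \<in> rootless_quadratics" shows "subgroup (torus p) PGL2"
proof -
  interpret PGL: Group.group "PGL2 :: ('a ^ 2 ^ 2) set monoid" by (rule group_PGL2)
  obtain b d where bd: "p = (b, d)" by (cases p)
  have inv: "invertible (quad_mat b d x y)" if "(x, y) \<noteq> (0, 0)" for x y
    using p that invertible_quad_mat bd by blast
  have nz: "(x, y) \<noteq> (0, 0)" if "invertible (quad_mat b d x y)" for x y
    using that by (auto simp: invertible_det_nz det_2)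
  show ?thesis
  proof (rule PGL.subgroupI)
    show "torus p \<subseteq> carrier PGL2" using p by (rule torus_subset_carrier)
    show "torus p \<noteq> {}" by (auto simp: torus_def bd intro!: exI[of _ 1])
    show "X \<otimes>\<^bsub>PGL2\<^esub> Y \<in> torus p" if XY: "X \<in> torus p" "Y \<in> torus p" for X Y
    proof -
      obtain x y x' y' where xy: "X = coset2 (quad_mat b d x y)" "(x, y) \<noteq> (0, 0)"
        "Y = coset2 (quad_mat b d x' y')" "(x', y') \<noteq> (0, 0)"
        using XY unfolding torus_def bd by blast
      \<comment> \<open>The product matrix is invertible, so its parameters cannot both
        vanish.\<close>
      have "(x * x' + y * y' * b, x * y' + y * x' + y * y' * d) \<noteq> (0, 0)"
        using inv[OF xy(2)] inv[OF xy(4)] by (intro nz) (metis invertible_mult quad_mat_mult)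
      then show ?thesis
        using inv[OF xy(2)] inv[OF xy(4)] xy
        by (auto simp: mult_PGL2 quad_mat_mult torus_def bd simp del: prod.inject)
    qed
    show "inv\<^bsub>PGL2\<^esub> X \<in> torus p" if X: "X \<in> torus p" for X
    proof -
      obtain x y where xy: "X = coset2 (quad_mat b d x y)" "(x, y) \<noteq> (0, 0)"
        using X unfolding torus_def bd by blast
      \<comment> \<open>This is the conjugate x + y(d - \<theta>), as d - \<theta> is the other
        root; its product with x + y\<theta> is the norm, a scalar.\<close>
      let ?Y = "quad_mat b d (x + y * d) (- y)"
      have nz': "(x + y * d, - y) \<noteq> (0, 0)" using xy(2) by auto
      have "?Y ** quad_mat b d x y = mat (x * (x + y * d) - y * y * b)"
        unfolding quad_mat_mult quad_mat_scalar[of b d, symmetric] by (simp add: algebra_simps)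
      moreover have "invertible (?Y ** quad_mat b d x y)"
        using inv[OF xy(2)] inv[OF nz'] by (rule invertible_mult[rotated])
      ultimately have "coset2 (?Y ** quad_mat b d x y) = \<one>\<^bsub>PGL2\<^esub>"
        using coset2_scale[of "x * (x + y * d) - y * y * b" "mat 1"]
        by (simp add: one_PGL2 mat_invertible)
      then have "inv\<^bsub>PGL2\<^esub> X = coset2 ?Y"
        using inv[OF xy(2)] inv[OF nz'] xy
        by (intro PGL.inv_equality) (auto simp: mult_PGL2 carrier_PGL2)
      then show ?thesis using nz' unfolding torus_def bd by blast
    qed
  qed
qed

text \<open>Reading a vector v as v1 + v2\<theta>, both sides are the product of u and v, which
  commutes.\<close>

lemma quad_mat_vec_commute:
  "quad_mat b d (v $ 1) (v $ 2) *v u = quad_mat b d (u $ 1) (u $ 2) *v v"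
  by (simp add: vec_eq_iff forall_2 matrix_vector_mult_def sum_2 algebra_simps)

lemma transitive_torus:
  assumes p: "p \<in> rootless_quadratics" and ij: "i \<in> proj_line" "j \<in> proj_line"
  shows "\<exists>c\<in>torus p. PGL2_act c i = j"
proof -
  obtain b d where bd: "p = (b, d)" by (cases p)
  obtain v w where vw: "v \<noteq> 0" "i = vec.span {v}" "w \<noteq> 0" "j = vec.span {w}"
    using ij by (auto simp: proj_line_eq)
  have "(v $ 1, v $ 2) \<noteq> (0, 0)" using vw(1) by (auto simp: vec_eq_iff forall_2)
  then obtain N where N: "quad_mat b d (v $ 1) (v $ 2) ** N = mat 1"
    using p bd invertible_quad_mat by (metis invertible_def)
  \<comment> \<open>As an element of the extension u is the quotient w / v, so multiplication by u
    carries v to w.\<close>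
  define u where "u = N *v w"
  have "quad_mat b d (v $ 1) (v $ 2) *v u = w"
    using N by (simp add: u_def matrix_vector_mul_assoc)
  then have u: "quad_mat b d (u $ 1) (u $ 2) *v v = w" by (metis quad_mat_vec_commute)
  have "u \<noteq> 0" using vw(3) u by (auto simp: matrix_vector_mult_def vec_eq_iff sum_2 forall_2)
  then have "(u $ 1, u $ 2) \<noteq> (0, 0)" by (auto simp: vec_eq_iff forall_2)
  then have "coset2 (quad_mat b d (u $ 1) (u $ 2)) \<in> torus p" by (auto simp: torus_def bd)
  then show ?thesis using u vw by (metis PGL2_act_span)
qed

text \<open>A fixed line would give an eigenvector with some eigenvalue k. Subtracting k only shifts
  x, and since y is nonzero the shifted matrix is still invertible, so it cannot kill the
  eigenvector.\<close>

lemma torus_subset_Der: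
  assumes p: "p \<in> rootless_quadratics" and c: "c \<in> torus p" "c \<noteq> \<one>\<^bsub>PGL2\<^esub>"
  shows "c \<in> Der PGL2 proj_line PGL2_act"
proof -
  obtain b d where bd: "p = (b, d)" by (cases p)
  obtain x y where xy: "c = coset2 (quad_mat b d x y)" "(x, y) \<noteq> (0, 0)"
    using c by (auto simp: torus_def bd)
  \<comment> \<open>With y = 0 the matrix is scalar and its coset is the identity.\<close>
  have y: "y \<noteq> 0"
  proof
    assume "y = 0"
    then show False using c(2) xy coset2_scale[of x "mat 1"] by (simp add: quad_mat_scalar one_PGL2)
  qed
  have "PGL2_act c L \<noteq> L" if "L \<in> proj_line" for L
  proof
    assume fixed: "PGL2_act c L = L"
    obtain v where v: "v \<noteq> 0" "L = vec.span {v}" using \<open>L \<in> proj_line\<close> by (auto simp: proj_line_eq)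
    have "quad_mat b d x y *v v \<noteq> 0"
      using inj_mult_vec[OF invertible_quad_mat] p bd xy(2) v(1) by blast
    then obtain k where "quad_mat b d x y *v v = k *s v"
      using fixed v xy by (auto simp: PGL2_act_span span_eq_iff2)
    then have "quad_mat b d (x - k) y *v v = 0"
      by (simp add: vec_eq_iff forall_2 matrix_vector_mult_def sum_2 algebra_simps)
    moreover have "quad_mat b d (x - k) y *v v \<noteq> 0"
      using inj_mult_vec[OF invertible_quad_mat] p bd y v(1) by blast
    ultimately show False by simp
  qed
  then show ?thesis using torus_subset_carrier[OF p] c(1) by (auto simp: Der_def)
qed

text \<open>When y is nonzero, the ratios of the upper right entry and of the difference of the
  diagonal entries to y recover b and d, and they do not change under scaling.\<close>

lemma torus_disjoint:
  assumes "c \<in> torus p" "c \<in> torus p'" "c \<noteq> \<one>\<^bsub>PGL2\<^esub>"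
  shows "p = p'"
proof -
  obtain b d b' d' where bd: "p = (b, d)" "p' = (b', d')" by (cases p, cases p')
  obtain x y where xy: "c = coset2 (quad_mat b d x y)" "(x, y) \<noteq> (0, 0)"
    using assms(1) by (auto simp: torus_def bd)
  obtain x' y' where xy': "c = coset2 (quad_mat b' d' x' y')"
    using assms(2) by (auto simp: torus_def bd)
  have y: "y \<noteq> 0"
  proof
    assume "y = 0"
    then show False using assms(3) xy coset2_scale[of x "mat 1"]
      by (simp add: quad_mat_scalar one_PGL2)
  qed
  obtain k where k: "quad_mat b d x y = mat k ** quad_mat b' d' x' y'"
    using xy(1) xy' coset2_eqD by metis
  have "quad_mat b d x y $ i $ j = k * quad_mat b' d' x' y' $ i $ j" for i j
    by (simp add: k mat_mult_nth)
  from this[of 1 1] this[of 1 2] this[of 2 1] this[of 2 2]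
  have "x = k * x'" "y * b = y * b'" "y = k * y'" "y * d = y * d'"
    by (auto simp: algebra_simps)
  then show ?thesis using y bd by simp
qed

lemma torus_covers_Der:
  assumes "c \<in> Der PGL2 proj_line PGL2_act"
  shows "\<exists>p\<in>rootless_quadratics. c \<in> torus p"
proof -
  obtain A where A: "c = coset2 A" "invertible A"
    using assms by (auto simp: Der_def carrier_PGL2)
  have no_eigenvector: "A *v v \<noteq> k *s v" if v: "v \<noteq> 0" for v k
  proof
    assume k: "A *v v = k *s v"
    then have "A *v v \<noteq> 0" using inj_mult_vec[OF A(2) v] by blast
    then have "PGL2_act c (vec.span {v}) = vec.span {v}"
      using k v A by (auto simp: PGL2_act_span span_eq_iff2)
    moreover have "vec.span {v} \<in> proj_line" using v by (auto simp: proj_line_eq)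
    ultimately show False using assms by (auto simp: Der_def)
  qed
  \<comment> \<open>The parameters solve \<open>A = quad_mat b d x y\<close> entry by entry, which
    requires a nonzero lower left entry.\<close>
  define x y b d where "x = A $ 1 $ 1" and "y = A $ 2 $ 1"
    and "b = A $ 1 $ 2 / y" and "d = (A $ 2 $ 2 - x) / y"
  have "y \<noteq> 0"
  proof
    assume "y = 0"
    then have "A *v vector [1, 0] = x *s vector [1, 0]"
      by (simp add: x_def y_def vec_eq_iff forall_2 matrix_vector_mult_def sum_2)
    then show False using no_eigenvector[of "vector [1, 0]"] by (auto simp: vec_eq_iff forall_2)
  qed
  then have A_eq: "A = quad_mat b d x y"
    by (simp add: vec_eq_iff forall_2 x_def b_def d_def) (simp add: y_def)
  have "z * z \<noteq> d * z + b" for z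
  proof
    assume z: "z * z = d * z + b"
    \<comment> \<open>A root z splits the quadratic as (X - z)(X - (d - z)), so \<theta> acts on the
      vector of \<theta> - (d - z) as multiplication by z; hence the eigenvalue x + yz.\<close>
    let ?v = "vector [z - d, 1] :: 'a ^ 2"
    have "A *v ?v = (x + y * z) *s ?v"
    proof -
      have b: "b = z * z - d * z" using z by simp
      show ?thesis
        unfolding A_eq b by (simp add: vec_eq_iff forall_2 matrix_vector_mult_def sum_2 algebra_simps)
    qed
    moreover have "?v \<noteq> 0" by (auto simp: vec_eq_iff forall_2)
    ultimately show False using no_eigenvector by blast
  qed
  then have "(b, d) \<in> rootless_quadratics" by (simp add: rootless_quadratics_def)
  moreover have "c \<in> torus (b, d)" using A A_eq \<open>y \<noteq> 0\<close> by (auto simp: torus_def)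
  ultimately show ?thesis by blast
qed

section \<open>The general result applied to PGL(2,q)\<close>

interpretation PGL2: regular_derangement_partition
  "PGL2 :: ('a::{field,finite} ^ 2 ^ 2) set monoid" proj_line PGL2_act "torus ` rootless_quadratics"
proof (intro regular_derangement_partition.intro group_action_PGL2
    regular_derangement_partition_axioms.intro)
  have "card (proj_line :: ('a ^ 2) set set) \<ge> 2"
    by (simp add: card_proj_line Suc_leI)
  then show "\<exists>i\<in>proj_line. \<exists>j\<in>proj_line. i \<noteq> (j :: ('a ^ 2) set)"
    by (metis card_le_Suc0_iff_eq finite not_less_eq_eq numeral_2_eq_2)
qed (auto simp: subgroup_torus transitive_torus torus_covers_Der
    dest: torus_disjoint intro: torus_subset_Der)

lemma card_tori:
  "card (torus ` (rootless_quadratics :: ('a::{field,finite} \<times> 'a) set)) = CARD('a) choose 2"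
proof -
  have "inj_on torus (rootless_quadratics :: ('a \<times> 'a) set)"
  proof (rule inj_onI)
    fix p p' :: "'a \<times> 'a" assume eq: "torus p = torus p'"
    \<comment> \<open>The class of \<theta> itself: its lower left entry is 1, so it is not the
      identity and lies in only one torus.\<close>
    let ?c = "coset2 (quad_mat (fst p) (snd p) 0 1)"
    have "(0 :: 'a, 1 :: 'a) \<noteq> (0, 0)" by simp
    then have "?c \<in> torus p" unfolding torus_def split_beta by blast
    moreover have "?c \<noteq> \<one>\<^bsub>PGL2\<^esub>"
    proof
      assume "?c = \<one>\<^bsub>PGL2\<^esub>"
      then obtain k where "quad_mat (fst p) (snd p) 0 1 = mat k ** mat 1"
        unfolding one_PGL2 by (rule coset2_eqD)
      then have "quad_mat (fst p) (snd p) 0 1 $ 2 $ 1 = (mat k :: 'a ^ 2 ^ 2) $ 2 $ 1" by simp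
      then show False by (simp add: mat_def)
    qed
    ultimately show "p = p'" using eq torus_disjoint by metis
  qed
  then show ?thesis by (simp add: card_image card_rootless_quadratics)
qed

theorem theorem5p2:
  fixes q :: nat
    and G :: "('a::{field,finite} ^ 2 ^ 2) set monoid"
    and \<Omega> :: "('a ^ 2) set set"
    and \<phi> :: "('a ^ 2 ^ 2) set \<Rightarrow> ('a ^ 2) set \<Rightarrow> ('a ^ 2) set"
  assumes "CARD('a) = q"
  defines "G \<equiv> PGL2" and "\<Omega> \<equiv> proj_line" and "\<phi> \<equiv> PGL2_act"
  shows "real (min_labels G \<Omega> \<phi>) = (real q - 1) * real q / 2 \<and>
    (\<forall>D. D \<subseteq> Der G \<Omega> \<phi> \<longrightarrow> inverse_closed G D \<longrightarrow>
       real (num_labels G D) < (real q - 1) * real q / 2 \<longrightarrow>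
       independence_number (Cay G (Der G \<Omega> \<phi> - D)) = independence_number (derangement_graph G \<Omega> \<phi>) \<and>
       real (independence_number (derangement_graph G \<Omega> \<phi>)) = real (order G) / (real q + 1)) \<and>
    EKR_robust G \<Omega> \<phi>"
proof -
  \<comment> \<open>This makes the truncated q - 1 in the binomial coefficient agree with the real
    difference.\<close>
  have "q \<ge> 1" using assms(1) by (metis One_nat_def Suc_leI zero_less_card_finite)
  then have q: "real (q choose 2) = (real q - 1) * real q / 2"
    by (simp add: choose_two real_of_nat_div)
  have min: "min_labels G \<Omega> \<phi> = q choose 2"
    unfolding G_def \<Omega>_def \<phi>_def PGL2.min_labels_eq card_tori assms(1) ..
  have card: "card \<Omega> = q + 1" by (simp add: \<Omega>_def card_proj_line assms(1))
  have ind: "real (independence_number (Cay G (Der G \<Omega> \<phi> - D))) = real (order G) / (real q + 1)"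
    if "D \<subseteq> Der G \<Omega> \<phi>" "num_labels G D < q choose 2" for D
  proof -
    have "independence_number (Cay G (Der G \<Omega> \<phi> - D)) * (q + 1) = order G"
      using PGL2.independence_number_few_labels[of D] that card
      unfolding G_def \<Omega>_def \<phi>_def card_tori assms(1) by simp
    then have "real (independence_number (Cay G (Der G \<Omega> \<phi> - D))) * (real q + 1) = real (order G)"
      by (metis of_nat_1 of_nat_add of_nat_mult)
    then show ?thesis by (simp add: field_simps)
  qed
  \<comment> \<open>The full derangement graph is the case of empty D, which has zero labels. Any D
    below the bound shows that the bound is positive.\<close>
  have full: "real (independence_number (derangement_graph G \<Omega> \<phi>)) = real (order G) / (real q + 1)"
    if "0 < q choose 2"
    using ind[of "{}"] that by (simp add: derangement_graph_def num_labels_def labels_def)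
  have "independence_number (Cay G (Der G \<Omega> \<phi> - D)) = independence_number (derangement_graph G \<Omega> \<phi>) \<and>
      real (independence_number (derangement_graph G \<Omega> \<phi>)) = real (order G) / (real q + 1)"
    if "D \<subseteq> Der G \<Omega> \<phi>" "num_labels G D < q choose 2" for D
    using ind[OF that] full[OF le_less_trans[OF le0 that(2)]] by simp
  moreover have "EKR_robust G \<Omega> \<phi>"
    unfolding EKR_robust_def min card using ind by (simp add: add.commute)
  ultimately show ?thesis
    unfolding min q[symmetric] of_nat_less_iff by blast
qed

end
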